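(* For every $\eta>0$ and every sufficiently large integer constant $c$ (depending on $\eta$) there is a constant $C$ such that for every $k\ge 2$ the following holds. If $k$ stations execute the protocol NonAdaptiveWithK$(k,c)$ and are activated by any adaptive adversary, then with probability at least $1-1/k^{\eta}$ the total number of broadcast attempts (transmissions, successful or not, by all stations together) during the execution is at most $C k\log k$.
   Context: Model. $k$ anonymous identical stations share a channel. Time is divided into discrete synchronous rounds; there is no global clock available to the stations and no collision detection. Initially all stations are asleep. Each station holds one packet and is activated once, at a time chosen by an adversary. The activation round is round $0$ of the station's local clock, and the station may transmit from its local round $1$ on. In each round every active station either transmits or listens. A transmission is successful if and only if exactly one active station transmits in that round; the transmitter then receives an acknowledgement. In all other cases nothing is received. The algorithm is non-adaptive: transmission decisions depend only on the local round number (and private randomness), and a station switches off permanently right after its first successful transmission. An adaptive adversary decides online which station to activate and when, knowing the algorithm's code and the history of the computation but not future randomness; in total it activates $k$ stations. Protocol NonAdaptiveWithK$(k,c)$ (executed by each station from its activation, $\log$ is base $2$): for $0\le l\le \log\log k$ let $\varphi(l)=k/2^l$ if $l<\log\log k$ and $\varphi(l)=k$ if $l=\log\log k$. For $l=0,1,2,\ldots,\log\log k$: for $c\varphi(l)$ rounds, transmit in each round with probability $\frac{2^l}{2k}$, independently over rounds and stations. A station that has finished all iterations transmits no more. Quantities such as $\log\log k$ and $k/2^l$ are treated as integers (rounding is ignored). *)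

theory Defs
  imports "HOL-Probability.Probability" "HOL-Probability.Product_PMF"
begin

text \<open>
  Stations are named \<open>0, \<dots>, k - 1\<close>; the names are visible to the adversary only. A history
  lists, for each of the rounds \<open>0, \<dots>, t - 1\<close>, the set of stations activated in that round and the
  set of stations transmitting in it. Acknowledgements are determined by the latter.
  The adversary maps the history of all previous rounds to the set of stations
  activated in the current round.
\<close>

type_synonym history = "(nat set \<times> nat set) list"

type_synonym adversary = "history \<Rightarrow> nat set"

definition awakened :: "history \<Rightarrow> nat set" where
  "awakened h = (\<Union>r\<in>set h. fst r)"

definition succeeded :: "history \<Rightarrow> nat set" where
  "succeeded h = {i. \<exists>r\<in>set h. snd r = {i}}"

text \<open>
  The local round number, in the round following the history \<open>h\<close> (that is, in the global round
  \<open>length h\<close>), of a station \<open>i \<in> awakened h\<close>. It is at least 1, since the activation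
  round itself has local number 0.
\<close>

definition local_round :: "history \<Rightarrow> nat \<Rightarrow> nat" where
  "local_round h i = length h - (LEAST t. t < length h \<and> i \<in> fst (h ! t))"

text \<open>
  A non-adaptive protocol is the list \<open>p\<close> of its transmission probabilities, with the probability
  for local round \<open>j \<ge> 1\<close> stored at position \<open>j - 1\<close>. The coin \<open>\<omega> (i, j)\<close> decides whether
  station \<open>i\<close>, if it has not switched off by then, transmits in its local round \<open>j\<close>. All coins are
  independent, and the adversary learns about a coin only through the resulting transmission.
\<close>

definition coins :: "nat \<Rightarrow> real list \<Rightarrow> (nat \<times> nat \<Rightarrow> bool) pmf" where
  "coins k p =
     Pi_pmf ({..<k} \<times> {1..length p}) False (\<lambda>(i, j). bernoulli_pmf (p ! (j - 1)))"

definition transmitters :: "real list \<Rightarrow> (nat \<times> nat \<Rightarrow> bool) \<Rightarrow> history \<Rightarrow> nat set" where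
  "transmitters p \<omega> h =
     {i \<in> awakened h - succeeded h. local_round h i \<le> length p \<and> \<omega> (i, local_round h i)}"

primrec run :: "real list \<Rightarrow> adversary \<Rightarrow> (nat \<times> nat \<Rightarrow> bool) \<Rightarrow> nat \<Rightarrow> history" where
  "run p adv \<omega> 0 = []"
| "run p adv \<omega> (Suc t) =
     run p adv \<omega> t @ [(adv (run p adv \<omega> t), transmitters p \<omega> (run p adv \<omega> t))]"

text \<open>
  Whatever the coins, the adversary activates each of the \<open>k\<close> stations exactly once.
\<close>

definition valid_adversary :: "nat \<Rightarrow> real list \<Rightarrow> adversary \<Rightarrow> bool" where
  "valid_adversary k p adv \<longleftrightarrow>
     (\<forall>\<omega>. (\<forall>t. adv (run p adv \<omega> t) \<subseteq> {..<k} - awakened (run p adv \<omega> t)) \<and>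
          (\<exists>t. awakened (run p adv \<omega> t) = {..<k}))"

definition attempts :: "real list \<Rightarrow> adversary \<Rightarrow> (nat \<times> nat \<Rightarrow> bool) \<Rightarrow> (nat \<times> nat) set" where
  "attempts p adv \<omega> = {(t, i). i \<in> transmitters p \<omega> (run p adv \<omega> t)}"

text \<open>
  Non-integral values of \<open>log log k\<close> and \<open>k / 2^l\<close> are rounded up.
\<close>

definition loglog :: "nat \<Rightarrow> nat" where
  "loglog k = nat \<lceil>log 2 (log 2 (real k))\<rceil>"

definition phi :: "nat \<Rightarrow> nat \<Rightarrow> nat" where
  "phi k l = (if l < loglog k then nat \<lceil>real k / 2 ^ l\<rceil> else k)"

definition NonAdaptiveWithK :: "nat \<Rightarrow> nat \<Rightarrow> real list" where
  "NonAdaptiveWithK k c =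
     concat (map (\<lambda>l. replicate (c * phi k l) (2 ^ l / (2 * real k))) [0..<Suc (loglog k)])"

text \<open>
  Rounding up does not push a transmission probability above 1, so the truncation built into
  \<^const>\<open>bernoulli_pmf\<close> is never active.
\<close>

lemma NonAdaptiveWithK_probabilities:
  assumes "k \<ge> 2" "q \<in> set (NonAdaptiveWithK k c)"
  shows "0 < q" "q \<le> 1"
proof -
  have "\<exists>l\<le>loglog k. q = 2 ^ l / (2 * real k)"
    using assms(2) unfolding NonAdaptiveWithK_def by (auto simp del: upt_Suc simp: less_Suc_eq_le set_replicate_conv_if split: if_split_asm)
  then obtain l where l: "l \<le> loglog k" "q = 2 ^ l / (2 * real k)" by blast
  show "0 < q" using l assms by simp
  have lg: "log 2 (real k) \<ge> 1" using assms(1) by simp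
  have "log 2 (log 2 (real k)) \<ge> 0" using lg by simp
  then have "real l \<le> log 2 (log 2 (real k)) + 1"
    using l(1) unfolding loglog_def by linarith
  then have "2 powr real l \<le> 2 powr (log 2 (log 2 (real k)) + 1)" by simp
  also have "\<dots> = 2 * log 2 (real k)" using lg by (simp add: powr_add)
  also have "log 2 (real k) \<le> real k"
    using assms(1) less_exp[of k] by (simp add: log_le_iff powr_realpow order_less_imp_le)
  finally have "2 ^ l \<le> 2 * real k" by (simp add: powr_realpow)
  then show "q \<le> 1" using l assms(1) by simp
qed

end

theory Submission
  imports Defs
begin

text \<open>
  Distinct attempts use distinct coins, whatever the adversary does, so the number of attempts is at
  most the number \<open>X\<close> of coins that come up true. This is a sum of independent Bernoulli variables
  of total mean \<open>\<Sum>l. c \<phi>(l) 2^l / 2 = O(c k log k)\<close>, where the last iteration alone contributes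
  \<open>k 2^loglog k = \<Theta>(k log k)\<close> and each of the others \<open>O(k)\<close>. The bound on the
  exponential moment \<open>E (exp X)\<close> and Markov's inequality finish the proof, for every \<open>c\<close>.
\<close>

lemma length_run [simp]: "length (run p adv \<omega> t) = t"
  by (induction t) auto

lemma nth_run: "s < t \<Longrightarrow> fst (run p adv \<omega> t ! s) = adv (run p adv \<omega> s)"
  by (induction t) (auto simp: nth_append less_Suc_eq)

lemma awakened_run: "awakened (run p adv \<omega> t) = (\<Union>s<t. adv (run p adv \<omega> s))"
  by (induction t) (auto simp: awakened_def less_Suc_eq)

text \<open>The activation round \<open>a\<close> is read off the whole run and so does not depend
  on \<open>t\<close>. Hence for a fixed station the local round is the global round shifted by a
  constant.\<close>

lemma local_round_run:
  assumes "i \<in> awakened (run p adv \<omega> t)"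
  defines "a \<equiv> LEAST s. i \<in> adv (run p adv \<omega> s)"
  shows "a < t" "local_round (run p adv \<omega> t) i = t - a"
proof -
  obtain s where s: "s < t" "i \<in> adv (run p adv \<omega> s)"
    using assms(1) by (auto simp: awakened_run)
  have a: "i \<in> adv (run p adv \<omega> a)" unfolding a_def using s(2) by (rule LeastI)
  have min: "a \<le> r" if "i \<in> adv (run p adv \<omega> r)" for r
    unfolding a_def using that by (rule Least_le)
  show "a < t" using min[OF s(2)] s(1) by simp
  \<comment> \<open>The guard \<open>s < t\<close> in \<open>local_round\<close> does not change the
    minimum, since the minimiser \<open>a\<close> itself lies below \<open>t\<close>.\<close>
  then have "(LEAST s. s < t \<and> i \<in> fst (run p adv \<omega> t ! s)) = a"
    using a min by (intro Least_equality) (auto simp: nth_run)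
  then show "local_round (run p adv \<omega> t) i = t - a"
    by (simp add: local_round_def)
qed

text \<open>Each transmission is charged to the coin that caused it. The charging map is injective
  for each fixed outcome \<omega>, so an adaptive adversary cannot make one coin count
  twice.\<close>

lemma attempts_le_true_coins:
  assumes "valid_adversary k p adv"
  shows "finite (attempts p adv \<omega>)"
    and "card (attempts p adv \<omega>) \<le> card {x \<in> {..<k} \<times> {1..length p}. \<omega> x}"
proof -
  let ?f = "\<lambda>(t, i). (i, local_round (run p adv \<omega> t) i)"
  let ?T = "{x \<in> {..<k} \<times> {1..length p}. \<omega> x}"
  have aw: "i \<in> awakened (run p adv \<omega> t)" if "(t, i) \<in> attempts p adv \<omega>" for t i
    using that by (auto simp: attempts_def transmitters_def)
  have inj: "inj_on ?f (attempts p adv \<omega>)"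
  proof (rule inj_onI, clarify)
    fix t i t'
    assume "(t, i) \<in> attempts p adv \<omega>" "(t', i) \<in> attempts p adv \<omega>"
      and "local_round (run p adv \<omega> t) i = local_round (run p adv \<omega> t') i"
    \<comment> \<open>Both sides are differences with the same activation round, which precedes
      \<open>t\<close> and \<open>t'\<close>, so the truncated subtraction on naturals can be
      cancelled.\<close>
    then show "t = t' \<and> i = i"
      using local_round_run[OF aw[of t i]] local_round_run[OF aw[of t' i]] by simp
  qed
  have sub: "?f ` attempts p adv \<omega> \<subseteq> ?T"
  proof clarify
    fix t i
    assume att: "(t, i) \<in> attempts p adv \<omega>"
    have "i < k"
      using aw[OF att] assms unfolding awakened_run valid_adversary_def by blast
    moreover have "local_round (run p adv \<omega> t) i \<ge> 1"
      using local_round_run[OF aw[OF att]] by simp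
    ultimately show "(i, local_round (run p adv \<omega> t) i) \<in> {..<k} \<times> {1..length p} \<and>
        \<omega> (i, local_round (run p adv \<omega> t) i)"
      using att by (auto simp: attempts_def transmitters_def)
  qed
  have fin: "finite ?T" by simp
  show "finite (attempts p adv \<omega>)"
    using finite_imageD[OF finite_subset[OF sub fin] inj] .
  show "card (attempts p adv \<omega>) \<le> card ?T"
    using card_inj_on_le[OF inj sub fin] .
qed

text \<open>A Chernoff bound with exponential parameter fixed at 1: Markov's inequality for
  \<open>exp X\<close>, whose mean factorises by independence into terms at most
  \<open>exp (2 * q x)\<close>.\<close>

lemma Pi_pmf_bernoulli_card_tail:
  fixes q :: "'a \<Rightarrow> real"
  assumes "finite A" and q: "\<And>x. x \<in> A \<Longrightarrow> 0 \<le> q x \<and> q x \<le> 1"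
  shows "measure_pmf.prob (Pi_pmf A d (\<lambda>x. bernoulli_pmf (q x)))
           {\<omega>. real (card {x \<in> A. \<omega> x}) \<ge> a} \<le> exp (2 * (\<Sum>x\<in>A. q x) - a)"
proof -
  let ?M = "Pi_pmf A d (\<lambda>x. bernoulli_pmf (q x))"
  let ?X = "\<lambda>\<omega>. real (card {x \<in> A. \<omega> x})"
  have exp_X: "exp (?X \<omega>) = (\<Prod>x\<in>A. if \<omega> x then exp 1 else 1)" for \<omega>
    using \<open>finite A\<close> by (simp add: prod.If_cases Int_def exp_of_nat_mult[symmetric])
  have "finite (set_pmf ?M)"
    using \<open>finite A\<close> by (subst set_Pi_pmf) (auto intro!: finite_PiE_dflt)
  then have int: "integrable ?M (\<lambda>\<omega>. exp (?X \<omega>))"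
    by (rule integrable_measure_pmf_finite)
  have "measure_pmf.prob ?M {\<omega>. ?X \<omega> \<ge> a} = measure_pmf.prob ?M {\<omega> \<in> space ?M. exp (?X \<omega>) \<ge> exp a}"
    by simp
  also have "\<dots> \<le> measure_pmf.expectation ?M (\<lambda>\<omega>. exp (?X \<omega>)) / exp a"
    by (rule integral_Markov_inequality_measure[OF int, where A = "{}"]) auto
  also have "measure_pmf.expectation ?M (\<lambda>\<omega>. exp (?X \<omega>)) =
      (\<Prod>x\<in>A. measure_pmf.expectation (bernoulli_pmf (q x)) (\<lambda>b. if b then exp 1 else 1))"
    unfolding exp_X using \<open>finite A\<close>
    by (intro expectation_prod_Pi_pmf integrable_measure_pmf_finite) auto
  also have "\<dots> \<le> (\<Prod>x\<in>A. exp (2 * q x))"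
  proof (rule prod_mono)
    fix x assume "x \<in> A"
    let ?E = "measure_pmf.expectation (bernoulli_pmf (q x)) (\<lambda>b. if b then exp 1 else 1 :: real)"
    from \<open>x \<in> A\<close> have qx: "0 \<le> q x" "q x \<le> 1" using q by auto
    have "?E = 1 + q x * (exp 1 - 1)"
      using qx by (simp add: algebra_simps)
    \<comment> \<open>The factor 2 comes from e \<le> 3.\<close>
    moreover have "q x * (exp 1 - 1) \<le> q x * 2"
      using qx exp_le by (intro mult_left_mono) auto
    moreover have "0 \<le> q x * (exp 1 - 1)"
      using qx by simp
    moreover have "1 + 2 * q x \<le> exp (2 * q x)"
      by (rule exp_ge_add_one_self)
    ultimately show "0 \<le> ?E \<and> ?E \<le> exp (2 * q x)"
      by (intro conjI) linarith+
  qed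
  also have "\<dots> = exp (2 * (\<Sum>x\<in>A. q x))"
    using \<open>finite A\<close> by (simp add: exp_sum sum_distrib_left)
  finally show ?thesis by (simp add: exp_diff divide_right_mono)
qed

lemma sum_list_concat_map:
  "sum_list (concat (map f xs)) = (\<Sum>x\<leftarrow>xs. sum_list (f x))"
  by (induction xs) auto

text \<open>The left side is the expected number of true coins. Iteration \<open>l\<close>
  contributes \<open>c * phi k l * 2 ^ l / 2\<close>, because \<open>k\<close> cancels against the
  probability's denominator.\<close>

lemma sum_list_NonAdaptiveWithK:
  assumes "k \<ge> 2"
  shows "real k * sum_list (NonAdaptiveWithK k c) \<le> 3 * real c * (real k * log 2 (real k))"
proof -
  define L where "L = loglog k"
  have lg: "log 2 (real k) \<ge> 1" using assms by simp
  then have "log 2 (log 2 (real k)) \<ge> 0" by simp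
  \<comment> \<open>Rounding the iterated logarithm up adds at most 1 to the exponent, which costs a
    factor 2 in \<open>2 ^ L\<close>.\<close>
  then have "real L \<le> log 2 (log 2 (real k)) + 1"
    unfolding L_def loglog_def by linarith
  then have "2 powr real L \<le> 2 powr (log 2 (log 2 (real k)) + 1)" by simp
  also have "\<dots> = 2 * log 2 (real k)" using lg by (simp add: powr_add)
  finally have pL: "2 ^ L \<le> 2 * log 2 (real k)" by (simp add: powr_realpow)
  have L_le: "real L \<le> 2 ^ L"
    using of_nat_less_two_power[of L, where ?'a = real] by simp
  have geo: "(\<Sum>l<L. 2 ^ l) \<le> (2 :: real) ^ L"
    by (induction L) auto
  have phi_le: "real (phi k l) * 2 ^ l \<le> real k + 2 ^ l" if "l < L" for l
  proof -
    have "real (phi k l) \<le> real k / 2 ^ l + 1"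
      using that of_int_ceiling_le_add_one[of "real k / 2 ^ l"] by (simp add: phi_def L_def)
    then have "real (phi k l) * 2 ^ l \<le> (real k / 2 ^ l + 1) * 2 ^ l"
      by (rule mult_right_mono) simp
    then show ?thesis by (simp add: algebra_simps)
  qed
  \<comment> \<open>The last iteration, of length governed by \<open>k\<close> itself, is split off;
    in the others the ceiling costs at most \<open>2 ^ l\<close>.\<close>
  have "(\<Sum>l<Suc L. real (phi k l) * 2 ^ l) \<le> (\<Sum>l<L. real k + 2 ^ l) + real k * 2 ^ L"
    using phi_le by (auto simp: phi_def L_def intro!: sum_mono)
  also have "\<dots> = real L * real k + (\<Sum>l<L. 2 ^ l) + real k * 2 ^ L"
    by (simp add: sum.distrib)
  \<comment> \<open>The last iteration already costs \<open>k * 2 ^ L\<close>, so this crude bound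
    on each of the other two terms suffices.\<close>
  also have "\<dots> \<le> real k * 2 ^ L + real k * 2 ^ L + real k * 2 ^ L"
  proof -
    have "real L * real k \<le> real k * 2 ^ L"
      using mult_right_mono[OF L_le, of "real k"] by (simp add: mult.commute)
    moreover have "(2 :: real) ^ L \<le> real k * 2 ^ L"
      using assms by simp
    ultimately show ?thesis using geo by linarith
  qed
  also have "\<dots> = 3 * (real k * 2 ^ L)" by simp
  also have "\<dots> \<le> 3 * (real k * (2 * log 2 (real k)))"
    using pL by (intro mult_left_mono) auto
  finally have phi_sum: "(\<Sum>l<Suc L. real (phi k l) * 2 ^ l) \<le> 6 * (real k * log 2 (real k))"
    by simp
  have "real k * sum_list (NonAdaptiveWithK k c) =
      real k * (\<Sum>l<Suc L. real (c * phi k l) * (2 ^ l / (2 * real k)))"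
    unfolding NonAdaptiveWithK_def L_def
    by (simp add: sum_list_concat_map sum_list_replicate interv_sum_list_conv_sum_set_nat
        atLeast0LessThan del: upt_Suc sum.lessThan_Suc)
  also have "\<dots> = real c / 2 * (\<Sum>l<Suc L. real (phi k l) * 2 ^ l)"
    unfolding sum_distrib_left using assms by (intro sum.cong) (auto simp: field_simps)
  also have "\<dots> \<le> real c / 2 * (6 * (real k * log 2 (real k)))"
    using phi_sum by (rule mult_left_mono) simp
  finally show ?thesis by simp
qed

lemma sum_nth_pred_eq_sum_list: "(\<Sum>j\<in>{1..length p}. p ! (j - 1)) = sum_list p"
  by (simp add: sum.atLeast1_atMost_eq sum_list_sum_nth atLeast0LessThan)

theorem theorem3p2:
  "\<forall>\<eta>::real. \<eta> > 0 \<longrightarrow>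
     (\<exists>c0::nat. \<forall>c\<ge>c0. \<exists>C::real. \<forall>k::nat. k \<ge> 2 \<longrightarrow>
       (\<forall>adv. valid_adversary k (NonAdaptiveWithK k c) adv \<longrightarrow>
         measure_pmf.prob (coins k (NonAdaptiveWithK k c))
           {\<omega>. finite (attempts (NonAdaptiveWithK k c) adv \<omega>) \<and>
               real (card (attempts (NonAdaptiveWithK k c) adv \<omega>)) \<le> C * real k * log 2 (real k)}
         \<ge> 1 - 1 / real k powr \<eta>))"
\<comment> \<open>In the witness for \<open>C\<close>, the part \<open>6 * real c\<close> absorbs
  twice the mean, and \<eta> leaves the surplus that becomes the failure probability.\<close>
proof (rule allI, rule impI, rule exI[of _ 0], rule allI, rule impI,
    rule_tac x = "6 * real c + \<eta>" in exI, intro allI impI)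
  fix \<eta> :: real and c k :: nat and adv
  assume \<eta>: "\<eta> > 0" and k: "k \<ge> 2" and adv: "valid_adversary k (NonAdaptiveWithK k c) adv"
  define p where "p = NonAdaptiveWithK k c"
  define A where "A = {..<k} \<times> {1..length p}"
  define q where "q = (\<lambda>(i :: nat, j). p ! (j - 1))"
  define D where "D = real k * log 2 (real k)"
  define a where "a = (6 * real c + \<eta>) * D"
  let ?good = "{\<omega>. finite (attempts p adv \<omega>) \<and> real (card (attempts p adv \<omega>)) \<le> a}"
  let ?bad = "{\<omega>. real (card {x \<in> A. \<omega> x}) \<ge> a}"
  have coins: "coins k p = Pi_pmf A False (\<lambda>x. bernoulli_pmf (q x))"
    unfolding coins_def A_def q_def by (simp add: case_prod_unfold)
  have q: "0 \<le> q x \<and> q x \<le> 1" if "x \<in> A" for x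
  proof -
    have "q x \<in> set p" using that by (auto simp: A_def q_def)
    then show ?thesis
      using NonAdaptiveWithK_probabilities[OF k] unfolding p_def by (simp add: less_imp_le)
  qed
  have "(\<Sum>x\<in>A. q x) = real k * sum_list p"
    unfolding A_def q_def sum.cartesian_product[symmetric] sum_nth_pred_eq_sum_list by simp
  then have mean: "(\<Sum>x\<in>A. q x) \<le> 3 * real c * D"
    using sum_list_NonAdaptiveWithK[OF k] by (simp add: p_def D_def)
  \<comment> \<open>The surplus \<eta> \<open>* D\<close> must dominate \<eta>
    \<open>* ln (real k)\<close>, whose negative exponential is exactly the allowed failure
    probability.\<close>
  have "ln (real k) \<le> log 2 (real k)"
    using k ln_2_less_1 by (simp add: log_def field_simps mult_left_le)
  also have "\<dots> \<le> D"
    using k by (simp add: D_def)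
  finally have ln_le: "\<eta> * ln (real k) \<le> \<eta> * D"
    using \<eta> by simp
  have "measure_pmf.prob (coins k p) ?bad \<le> exp (2 * (\<Sum>x\<in>A. q x) - a)"
    unfolding coins by (rule Pi_pmf_bernoulli_card_tail) (use q in \<open>auto simp: A_def\<close>)
  also have "\<dots> \<le> exp (- (\<eta> * ln (real k)))"
    using mean ln_le by (simp add: a_def algebra_simps)
  also have "\<dots> = 1 / real k powr \<eta>"
    using k by (simp add: powr_def exp_minus field_simps)
  finally have bad: "measure_pmf.prob (coins k p) ?bad \<le> 1 / real k powr \<eta>" .
  \<comment> \<open>Only \<open>?bad\<close> is analysed probabilistically; the adversary enters
    through this pointwise inclusion alone.\<close>
  have "- ?bad \<subseteq> ?good"
  proof
    fix \<omega> assume "\<omega> \<in> - ?bad"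
    then show "\<omega> \<in> ?good"
      using attempts_le_true_coins[OF adv, of \<omega>] unfolding p_def A_def by auto
  qed
  then have "measure_pmf.prob (coins k p) (- ?bad) \<le> measure_pmf.prob (coins k p) ?good"
    by (intro measure_pmf.finite_measure_mono) auto
  moreover have "measure_pmf.prob (coins k p) (- ?bad) = 1 - measure_pmf.prob (coins k p) ?bad"
    using measure_pmf.prob_compl[of ?bad "coins k p"] by (simp add: Compl_eq_Diff_UNIV)
  ultimately have "1 - 1 / real k powr \<eta> \<le> measure_pmf.prob (coins k p) ?good"
    using bad by linarith
  then show "1 - 1 / real k powr \<eta> \<le> measure_pmf.prob (coins k (NonAdaptiveWithK k c))
      {\<omega>. finite (attempts (NonAdaptiveWithK k c) adv \<omega>) \<and>
        real (card (attempts (NonAdaptiveWithK k c) adv \<omega>))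
          \<le> (6 * real c + \<eta>) * real k * log 2 (real k)}"
    by (simp add: p_def a_def D_def mult.assoc)
qed

end
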